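(* Let $\theta$ be a diversity index satisfying the axioms $A_{01}$ and $A_{02}$. Then $\theta$ is fully determined by the entropic basis $\boldsymbol\zeta_1=\{\zeta_{1,v};v\ge 0\}$. That is, if $\mathbf p=\{p_k;k\ge1\}$ and $\mathbf q=\{q_k;k\ge1\}$ are probability distributions on countable alphabets (with finitely or infinitely many letters of positive probability) such that $$\sum_{k\ge1}p_k(1-p_k)^v=\sum_{k\ge1}q_k(1-q_k)^v\qquad\text{for every integer } v\ge0,$$ then $\theta(\mathbf p)=\theta(\mathbf q)$.
   Context: Let $\mathscr X=\{\ell_k;k\ge1\}$ be a countable alphabet and $\mathbf p=\{p_k;k\ge1\}$ a probability distribution on it. The number $K=\sum_{k\ge1}1[p_k>0]\in\{1,2,\dots\}\cup\{\infty\}$ is referred to as the cardinality of $\mathscr X$; accordingly, letters of probability zero are disregarded, i.e. two distributions differing only by inserting or deleting zero entries (and re-indexing) are identified. A diversity index is a function $\theta=\theta(\mathscr X,\mathbf p)$ with values in $[-\infty,\infty]$. The axioms are: - $A_{01}$: $\theta$ is fully determined by $\mathbf p$ (so $\theta=\theta(\mathbf p)$ does not depend on $\mathscr X$). - $A_{02}$: $\theta$ is invariant under any permutation of the index set $\{k;k\ge1\}$. For an integer $v\ge0$, $\zeta_{1,v}=\zeta_{1,v}(\mathbf p)=\sum_{k\ge1}p_k(1-p_k)^v$ (with $0^0=1$), and the entropic basis is $\boldsymbol\zeta_1=\{\zeta_{1,v};v\ge0\}$. *)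

theory Defs
  imports "HOL-Analysis.Analysis" "HOL-Combinatorics.Permutations"
begin

(* An alphabet {l_k; k >= 1} is an indexed family of distinct letters, given as a partial map
   whose domain is the index set: {1..n} for a finite alphabet, {1..} for an infinite one. *)
definition alphabet :: "(nat \<rightharpoonup> 'a) \<Rightarrow> bool" where
  "alphabet X \<longleftrightarrow> (dom X = {1..} \<or> (\<exists>n. dom X = {1..n})) \<and> inj_on X (dom X)"

(* Only the values of p on the index set dom X matter. *)
definition distribution_on :: "(nat \<rightharpoonup> 'a) \<Rightarrow> (nat \<Rightarrow> real) \<Rightarrow> bool" where
  "distribution_on X p \<longleftrightarrow>
     alphabet X \<and> (\<forall>k\<in>dom X. 0 \<le> p k) \<and> (p has_sum 1) (dom X)"

definition positive_indices :: "(nat \<rightharpoonup> 'a) \<Rightarrow> (nat \<Rightarrow> real) \<Rightarrow> nat set" where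
  "positive_indices X p = {k \<in> dom X. p k > 0}"

(* The two weighted alphabets differ only by inserting or deleting entries of probability zero.
   The remaining letters keep their probabilities and their order; s is the shift of indices
   caused by the insertions and deletions. Reordering is left to invariance under permutations. *)
definition differ_by_zero_entries ::
  "(nat \<rightharpoonup> 'a) \<Rightarrow> (nat \<Rightarrow> real) \<Rightarrow> (nat \<rightharpoonup> 'a) \<Rightarrow> (nat \<Rightarrow> real) \<Rightarrow> bool" where
  "differ_by_zero_entries X p Y q \<longleftrightarrow>
     (\<exists>s. bij_betw s (positive_indices X p) (positive_indices Y q) \<and>
          strict_mono_on (positive_indices X p) s \<and>
          (\<forall>k\<in>positive_indices X p. Y (s k) = X k \<and> q (s k) = p k))"

(* A function of a weighted alphabet that disregards letters of probability zero.
   Its values on pairs that are not weighted alphabets are unconstrained. *)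
definition diversity_index :: "((nat \<rightharpoonup> 'a) \<Rightarrow> (nat \<Rightarrow> real) \<Rightarrow> ereal) \<Rightarrow> bool" where
  "diversity_index \<theta> \<longleftrightarrow>
     (\<forall>X p Y q. distribution_on X p \<longrightarrow> distribution_on Y q \<longrightarrow>
        differ_by_zero_entries X p Y q \<longrightarrow> \<theta> X p = \<theta> Y q)"

definition axiom_A01 :: "((nat \<rightharpoonup> 'a) \<Rightarrow> (nat \<Rightarrow> real) \<Rightarrow> ereal) \<Rightarrow> bool" where
  "axiom_A01 \<theta> \<longleftrightarrow>
     (\<forall>X p Y q. distribution_on X p \<longrightarrow> distribution_on Y q \<longrightarrow>
        dom X = dom Y \<longrightarrow> (\<forall>k\<in>dom X. p k = q k) \<longrightarrow> \<theta> X p = \<theta> Y q)"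

definition axiom_A02 :: "((nat \<rightharpoonup> 'a) \<Rightarrow> (nat \<Rightarrow> real) \<Rightarrow> ereal) \<Rightarrow> bool" where
  "axiom_A02 \<theta> \<longleftrightarrow>
     (\<forall>X p \<pi>. distribution_on X p \<longrightarrow> \<pi> permutes dom X \<longrightarrow>
        \<theta> (X \<circ> \<pi>) (p \<circ> \<pi>) = \<theta> X p)"

definition zeta1 :: "(nat \<rightharpoonup> 'a) \<Rightarrow> (nat \<Rightarrow> real) \<Rightarrow> nat \<Rightarrow> real" where
  "zeta1 X p v = (\<Sum>\<^sub>\<infinity>k\<in>dom X. p k * (1 - p k) ^ v)"

end

theory Submission
  imports Defs "HOL-Computational_Algebra.Polynomial"
begin

text \<open>The basis determines \<open>\<Sum>\<^sub>k p\<^sub>k f(p\<^sub>k)\<close> for every polynomial \<open>f\<close>. For \<open>f(t) = (1 - (t - x)\<^sup>2)\<^sup>n\<close>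
  and \<open>0 < x \<le> 1\<close> these sums tend to \<open>x\<close> times the multiplicity of \<open>x\<close> in \<open>p\<close> as \<open>n \<rightarrow> \<infinity>\<close>, because
  the remaining probabilities stay away from \<open>x\<close>. Hence \<open>p\<close> and \<open>q\<close> have the same
  multiset of positive entries. After the zero entries are deleted, both index sets agree, and the two
  distributions differ by a permutation.\<close>

section \<open>Multiplicities of the probabilities\<close>

text \<open>Markov's inequality by counting: each index with value at least \<open>c\<close>
  contributes at least \<open>c\<close> to the total, so there are at most \<open>s / c\<close> of
  them.\<close>

lemma finite_superlevel_has_sum:
  fixes p :: "'b \<Rightarrow> real"
  assumes sum: "(p has_sum s) A" and nonneg: "\<And>k. k \<in> A \<Longrightarrow> 0 \<le> p k" and "0 < c"
  shows "finite {k \<in> A. c \<le> p k}"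
proof (rule ccontr)
  assume "infinite {k \<in> A. c \<le> p k}"
  then obtain F where F: "F \<subseteq> {k \<in> A. c \<le> p k}" "finite F" "card F = Suc (nat \<lceil>s / c\<rceil>)"
    using infinite_arbitrarily_large by blast
  have "real (card F) * c \<le> sum p F"
    using F(1) by (intro sum_bounded_below) auto
  also have "\<dots> \<le> s"
    using F nonneg by (intro has_sum_mono2[OF has_sum_finite sum]) auto
  finally have "real (card F) \<le> s / c"
    using \<open>0 < c\<close> by (simp add: pos_le_divide_eq)
  then show False
    using F(3) by linarith
qed

lemma has_sum_member_le:
  fixes p :: "'b \<Rightarrow> real"
  assumes "(p has_sum s) A" and "\<And>k. k \<in> A \<Longrightarrow> 0 \<le> p k" and "k \<in> A"
  shows "p k \<le> s"
  using has_sum_mono2[OF has_sum_finite[of "{k}" p] assms(1)] assms by auto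

lemma summable_on_mult_bounded:
  fixes p g :: "'b \<Rightarrow> real"
  assumes "p summable_on A" and "\<And>k. k \<in> A \<Longrightarrow> 0 \<le> p k" and "\<And>k. k \<in> A \<Longrightarrow> \<bar>g k\<bar> \<le> c"
  shows "(\<lambda>k. p k * g k) summable_on A"
proof (rule abs_summable_summable, rule Infinite_Sum.abs_summable_on_comparison_test')
  show "(\<lambda>k. p k * c) summable_on A"
    using assms(1) by (rule summable_on_cmult_left)
  show "norm (p k * g k) \<le> p k * c" if "k \<in> A" for k
    using assms(2,3)[OF that] by (simp add: abs_mult mult_left_mono)
qed

text \<open>Only finitely many values are at least \<open>x / 2\<close>, so those among them
  different from \<open>x\<close> cannot accumulate at \<open>x\<close>; all other values are
  further than \<open>x / 2\<close> away.\<close>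

lemma level_set_gap:
  fixes p :: "'b \<Rightarrow> real"
  assumes "(p has_sum s) A" and "\<And>k. k \<in> A \<Longrightarrow> 0 \<le> p k" and "0 < x"
  obtains d where "0 < d" "\<And>k. k \<in> A \<Longrightarrow> p k \<noteq> x \<Longrightarrow> d \<le> \<bar>p k - x\<bar>"
proof -
  \<comment> \<open>The element \<open>x / 2\<close> covers the values below \<open>x / 2\<close>
    and keeps the set nonempty, so that \<open>Min\<close> is meaningful.\<close>
  let ?F = "insert (x / 2) ((\<lambda>k. \<bar>p k - x\<bar>) ` {k \<in> A. x / 2 \<le> p k \<and> p k \<noteq> x})"
  have "finite {k \<in> A. x / 2 \<le> p k \<and> p k \<noteq> x}"
    by (rule finite_subset[OF _ finite_superlevel_has_sum[OF assms(1,2), of "x / 2"]])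
      (use \<open>0 < x\<close> in auto)
  then have fin: "finite ?F" by simp
  show thesis
  proof
    show "0 < Min ?F"
      using fin \<open>0 < x\<close> by (subst Min_gr_iff) auto
    fix k assume k: "k \<in> A" "p k \<noteq> x"
    show "Min ?F \<le> \<bar>p k - x\<bar>"
    proof (cases "x / 2 \<le> p k")
      case True
      then show ?thesis using k fin by (intro Min_le) auto
    next
      case False
      have "Min ?F \<le> x / 2" using fin by (intro Min_le) auto
      then show ?thesis using False by linarith
    qed
  qed
qed

text \<open>The factor \<open>1 - (p k - x)\<^sup>2\<close> is 1 on the level set of
  \<open>x\<close> and at most a constant below 1 elsewhere, so the remaining terms are dominated by
  a geometric sequence.\<close>

lemma multiplicity_as_limit:
  fixes p :: "'b \<Rightarrow> real"
  assumes sum: "(p has_sum 1) A" and nonneg: "\<And>k. k \<in> A \<Longrightarrow> 0 \<le> p k" and x: "0 < x" "x \<le> 1"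
  shows "(\<lambda>n. \<Sum>\<^sub>\<infinity>k\<in>A. p k * (1 - (p k - x)\<^sup>2) ^ n)
    \<longlonglongrightarrow> x * real (card {k \<in> A. p k = x})"
proof -
  obtain d where d: "0 < d" "\<And>k. k \<in> A \<Longrightarrow> p k \<noteq> x \<Longrightarrow> d \<le> \<bar>p k - x\<bar>"
    using level_set_gap[OF sum nonneg x(1)] by blast
  \<comment> \<open>Capping the gap at 1 keeps the ratio \<open>r = 1 - e\<^sup>2\<close>
    nonnegative.\<close>
  define e where "e = min d 1"
  have e: "0 < e" "e \<le> 1" "\<And>k. k \<in> A \<Longrightarrow> p k \<noteq> x \<Longrightarrow> e \<le> \<bar>p k - x\<bar>"
    using d by (fastforce simp: e_def)+
  define r where "r = 1 - e\<^sup>2"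
  have r: "0 \<le> r" "r < 1"
    using e by (auto simp: r_def power_le_one)
  let ?L = "{k \<in> A. p k = x}"
  let ?g = "\<lambda>n k. (1 - (p k - x)\<^sup>2) ^ n"
  have finL: "finite ?L"
    by (rule finite_subset[OF _ finite_superlevel_has_sum[OF sum nonneg x(1)]]) auto
  have base: "0 \<le> 1 - (p k - x)\<^sup>2" "1 - (p k - x)\<^sup>2 \<le> 1" if "k \<in> A" for k
  proof -
    \<comment> \<open>Both \<open>p k\<close> and \<open>x\<close> lie in the unit interval.\<close>
    have "\<bar>p k - x\<bar> \<le> 1"
      using has_sum_member_le[OF sum nonneg that] nonneg[OF that] x by linarith
    then show "0 \<le> 1 - (p k - x)\<^sup>2" by (simp add: abs_square_le_1)
  qed simp
  have psum: "p summable_on A" using sum by (auto simp: summable_on_def)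
  have summ: "(\<lambda>k. p k * ?g n k) summable_on A" for n
    by (rule summable_on_mult_bounded[OF psum nonneg, where c = 1])
      (use base in \<open>auto simp: power_abs intro!: power_le_one\<close>)
  have summR: "(\<lambda>k. p k * ?g n k) summable_on (A - ?L)" for n
    by (rule summable_on_subset_banach[OF summ]) auto
  define R where "R n = (\<Sum>\<^sub>\<infinity>k\<in>A - ?L. p k * ?g n k)" for n
  have split: "(\<Sum>\<^sub>\<infinity>k\<in>A. p k * ?g n k) = x * real (card ?L) + R n" for n
  proof -
    have "(\<Sum>\<^sub>\<infinity>k\<in>?L \<union> (A - ?L). p k * ?g n k) = (\<Sum>\<^sub>\<infinity>k\<in>?L. p k * ?g n k) + R n"
      unfolding R_def using finL summR by (intro infsum_Un_disjoint) auto
    moreover have "(\<Sum>\<^sub>\<infinity>k\<in>?L. p k * ?g n k) = (\<Sum>k\<in>?L. x)"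
      using finL by (simp del: sum_constant)
    moreover have "?L \<union> (A - ?L) = A" by auto
    ultimately show ?thesis by simp
  qed
  have R0: "0 \<le> R n" for n
    unfolding R_def using base nonneg by (intro infsum_nonneg) auto
  have R1: "R n \<le> r ^ n" for n
  proof -
    \<comment> \<open>Enlarging the range to all of \<open>A\<close> adds only nonnegative terms,
      and the bound then sums to \<open>r ^ n\<close> because \<open>p\<close> has total mass
      1.\<close>
    have "R n \<le> (\<Sum>\<^sub>\<infinity>k\<in>A. p k * r ^ n)"
      unfolding R_def
    proof (rule infsum_mono_neutral)
      show "(\<lambda>k. p k * ?g n k) summable_on (A - ?L)" by (rule summR)
      show "(\<lambda>k. p k * r ^ n) summable_on A"
        using psum by (rule summable_on_cmult_left)
      fix k assume "k \<in> (A - ?L) \<inter> A"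
      then have k: "k \<in> A" "p k \<noteq> x" by auto
      have "e\<^sup>2 \<le> (p k - x)\<^sup>2"
        using e(1) e(3)[OF k] by (simp add: abs_le_square_iff[symmetric])
      then have "?g n k \<le> r ^ n"
        using base(1)[OF k(1)] by (intro power_mono) (auto simp: r_def)
      then show "p k * ?g n k \<le> p k * r ^ n"
        using nonneg[OF k(1)] by (rule mult_left_mono)
    qed (use nonneg r in auto)
    also have "\<dots> = r ^ n"
      using infsumI[OF has_sum_cmult_left[OF sum, of "r ^ n"]] by simp
    finally show ?thesis .
  qed
  have "R \<longlonglongrightarrow> 0"
    by (rule tendsto_sandwich[OF _ _ tendsto_const LIMSEQ_realpow_zero[OF r]])
      (use R0 R1 in auto)
  then show ?thesis
    unfolding split using tendsto_add[OF tendsto_const, of R 0] by simp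
qed

section \<open>Polynomial sums in terms of the entropic basis\<close>

lemma has_sum_sum:
  fixes f :: "'i \<Rightarrow> 'b \<Rightarrow> 'c::topological_comm_monoid_add"
  assumes "\<And>i. i \<in> I \<Longrightarrow> (f i has_sum S i) A"
  shows "((\<lambda>k. \<Sum>i\<in>I. f i k) has_sum (\<Sum>i\<in>I. S i)) A"
  using assms by (induction I rule: infinite_finite_induct) (auto intro: has_sum_add)

text \<open>Expanding \<open>f\<close> in powers of \<open>1 - p k\<close> leaves a finite sum of
  convergent series, so the summations may be exchanged.\<close>

lemma infsum_mult_poly:
  fixes p :: "'b \<Rightarrow> real"
  assumes sum: "(p has_sum 1) A" and nonneg: "\<And>k. k \<in> A \<Longrightarrow> 0 \<le> p k"
  shows "(\<Sum>\<^sub>\<infinity>k\<in>A. p k * poly f (1 - p k))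
    = (\<Sum>i\<le>degree f. coeff f i * (\<Sum>\<^sub>\<infinity>k\<in>A. p k * (1 - p k) ^ i))"
proof -
  have "p summable_on A" using sum by (auto simp: summable_on_def)
  then have "(\<lambda>k. p k * (1 - p k) ^ i) summable_on A" for i
    by (rule summable_on_mult_bounded[OF _ nonneg, where c = 1])
      (use has_sum_member_le[OF sum nonneg] nonneg in \<open>auto simp: power_abs intro!: power_le_one\<close>)
  then have "((\<lambda>k. coeff f i * (p k * (1 - p k) ^ i)) has_sum
      coeff f i * (\<Sum>\<^sub>\<infinity>k\<in>A. p k * (1 - p k) ^ i)) A" for i
    by (intro has_sum_cmult_right has_sum_infsum)
  then have "((\<lambda>k. \<Sum>i\<le>degree f. coeff f i * (p k * (1 - p k) ^ i)) has_sum
      (\<Sum>i\<le>degree f. coeff f i * (\<Sum>\<^sub>\<infinity>k\<in>A. p k * (1 - p k) ^ i))) A"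
    by (intro has_sum_sum) auto
  moreover have "(\<lambda>k. \<Sum>i\<le>degree f. coeff f i * (p k * (1 - p k) ^ i))
      = (\<lambda>k. p k * poly f (1 - p k))"
    by (simp add: poly_altdef sum_distrib_left mult_ac)
  ultimately show ?thesis
    by (simp add: infsumI)
qed

lemma multiplicity_determined:
  fixes p :: "'b \<Rightarrow> real" and q :: "'c \<Rightarrow> real"
  assumes p: "(p has_sum 1) A" "\<And>k. k \<in> A \<Longrightarrow> 0 \<le> p k"
    and q: "(q has_sum 1) B" "\<And>k. k \<in> B \<Longrightarrow> 0 \<le> q k"
    and eq: "\<And>v. (\<Sum>\<^sub>\<infinity>k\<in>A. p k * (1 - p k) ^ v) = (\<Sum>\<^sub>\<infinity>k\<in>B. q k * (1 - q k) ^ v)"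
    and x: "0 < x"
  shows "card {k \<in> A. p k = x} = card {k \<in> B. q k = x}"
proof (cases "x \<le> 1")
  case True
  \<comment> \<open>At the argument \<open>1 - t\<close> the linear polynomial
    \<open>[:1 - x, -1:]\<close> takes the value \<open>t - x\<close>.\<close>
  let ?f = "\<lambda>n. (1 - [:1 - x, -1:]\<^sup>2) ^ n"
  have f: "poly (?f n) (1 - t) = (1 - (t - x)\<^sup>2) ^ n" for n t
    by (simp add: algebra_simps)
  have "(\<Sum>\<^sub>\<infinity>k\<in>A. p k * (1 - (p k - x)\<^sup>2) ^ n) = (\<Sum>\<^sub>\<infinity>k\<in>B. q k * (1 - (q k - x)\<^sup>2) ^ n)" for n
    using infsum_mult_poly[OF p, of "?f n"] infsum_mult_poly[OF q, of "?f n"]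
    unfolding f eq by simp
  then have "x * real (card {k \<in> A. p k = x}) = x * real (card {k \<in> B. q k = x})"
    using LIMSEQ_unique[OF multiplicity_as_limit[OF p x True]] multiplicity_as_limit[OF q x True]
    by simp
  then show ?thesis using x by simp
next
  case False
  \<comment> \<open>No probability exceeds the total mass 1.\<close>
  then have "{k \<in> A. p k = x} = {}" "{k \<in> B. q k = x} = {}"
    using has_sum_member_le[OF p] has_sum_member_le[OF q] by auto
  then show ?thesis by (simp only: card.empty)
qed

section \<open>From equal multiplicities to a bijection of indices\<close>

lemma bij_betw_fibres:
  assumes "\<And>y. \<exists>h. bij_betw h {k \<in> A. f k = y} {k \<in> B. g k = y}"
  obtains h where "bij_betw h A B" "\<And>k. k \<in> A \<Longrightarrow> g (h k) = f k"
proof -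
  obtain H where H: "\<And>y. bij_betw (H y) {k \<in> A. f k = y} {k \<in> B. g k = y}"
    using assms by metis
  \<comment> \<open>Each index is moved by the bijection of its own fibre; distinct fibres have
    disjoint images, so the pieces glue.\<close>
  define h where "h k = H (f k) k" for k
  have mem: "h k \<in> B \<and> g (h k) = f k" if "k \<in> A" for k
    using bij_betwE[OF H[of "f k"]] that by (auto simp: h_def)
  have "inj_on h A"
  proof (rule inj_onI)
    fix j k assume jk: "j \<in> A" "k \<in> A" "h j = h k"
    then have "f j = f k" using mem by metis
    with jk show "j = k"
      using inj_onD[OF bij_betw_imp_inj_on[OF H[of "f k"]], of j k] by (simp add: h_def)
  qed
  moreover have "B \<subseteq> h ` A"
  proof
    fix b assume "b \<in> B"
    then have "b \<in> H (g b) ` {k \<in> A. f k = g b}"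
      using bij_betw_imp_surj_on[OF H[of "g b"]] by simp
    then obtain k where "k \<in> A" "f k = g b" "b = H (g b) k" by blast
    then have "b = h k" by (simp add: h_def)
    with \<open>k \<in> A\<close> show "b \<in> h ` A" by blast
  qed
  ultimately have "bij_betw h A B"
    using mem by (auto simp: bij_betw_def)
  then show thesis using that mem by blast
qed

lemma bij_betw_positive_indices:
  assumes p: "distribution_on X p" and q: "distribution_on Y q"
    and eq: "\<And>v. zeta1 X p v = zeta1 Y q v"
  obtains h where "bij_betw h (positive_indices X p) (positive_indices Y q)"
    "\<And>k. k \<in> positive_indices X p \<Longrightarrow> q (h k) = p k"
proof (rule bij_betw_fibres)
  have p': "(p has_sum 1) (dom X)" "\<And>k. k \<in> dom X \<Longrightarrow> 0 \<le> p k"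
    and q': "(q has_sum 1) (dom Y)" "\<And>k. k \<in> dom Y \<Longrightarrow> 0 \<le> q k"
    using p q by (auto simp: distribution_on_def)
  fix x :: real
  show "\<exists>h. bij_betw h {k \<in> positive_indices X p. p k = x} {k \<in> positive_indices Y q. q k = x}"
  proof (cases "0 < x")
    case True
    have sets: "{k \<in> positive_indices X p. p k = x} = {k \<in> dom X. p k = x}"
      "{k \<in> positive_indices Y q. q k = x} = {k \<in> dom Y. q k = x}"
      using True by (auto simp: positive_indices_def)
    \<comment> \<open>Finiteness is essential: \<open>card\<close> is 0 on infinite sets, so equal
      cardinalities alone would yield no bijection.\<close>
    have "finite {k \<in> dom X. p k = x}"
      by (rule finite_subset[OF _ finite_superlevel_has_sum[OF p' True]]) auto
    moreover have "finite {k \<in> dom Y. q k = x}"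
      by (rule finite_subset[OF _ finite_superlevel_has_sum[OF q' True]]) auto
    moreover have "card {k \<in> dom X. p k = x} = card {k \<in> dom Y. q k = x}"
      by (rule multiplicity_determined[OF p' q' eq[unfolded zeta1_def] True])
    ultimately show ?thesis
      unfolding sets by (rule finite_same_card_bij)
  next
    case False
    then have "{k \<in> positive_indices X p. p k = x} = {}" "{k \<in> positive_indices Y q. q k = x} = {}"
      by (auto simp: positive_indices_def)
    then show ?thesis by (metis bij_betw_id)
  qed
qed (rule that)

section \<open>Deleting zero entries\<close>

text \<open>The canonical index set of an alphabet with as many letters as \<open>S\<close>. It
  depends only on the cardinality, so supports in bijection receive literally the same index set, as
  \<open>axiom_A01\<close> requires.\<close>

definition index_range :: "nat set \<Rightarrow> nat set" where
  "index_range S = (if finite S then {1..card S} else {1..})"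

lemma index_range_cong_bij_betw: "bij_betw h S T \<Longrightarrow> index_range S = index_range T"
  by (simp add: index_range_def bij_betw_finite bij_betw_same_card)

lemma index_range_enumeration:
  obtains e where "bij_betw e (index_range S) S" "strict_mono_on (index_range S) e"
proof -
  \<comment> \<open>The shift by one reconciles \<open>enumerate\<close>, which starts at 0, with
    indices starting at 1.\<close>
  let ?e = "\<lambda>k. enumerate S (k - 1)"
  show thesis
  proof (cases "finite S")
    case True
    have "bij_betw (\<lambda>k. k - 1) {1..card S} {..<card S}"
      by (rule bij_betw_byWitness[where f' = Suc]) auto
    from bij_betw_trans[OF this finite_bij_enumerate[OF True]]
    have "bij_betw ?e (index_range S) S" by (simp add: index_range_def True comp_def)
    moreover have "strict_mono_on (index_range S) ?e"
      using True by (auto simp: index_range_def intro!: strict_mono_onI finite_enumerate_mono)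
    ultimately show thesis by (rule that)
  next
    case False
    have "bij_betw (\<lambda>k. k - 1) {1..} (UNIV :: nat set)"
      by (rule bij_betw_byWitness[where f' = Suc]) auto
    from bij_betw_trans[OF this bij_enumerate[OF False]]
    have "bij_betw ?e (index_range S) S" by (simp add: index_range_def False comp_def)
    moreover have "strict_mono_on (index_range S) ?e"
      using False by (auto simp: index_range_def intro!: strict_mono_onI enumerate_mono)
    ultimately show thesis by (rule that)
  qed
qed

lemma strict_mono_on_inv_into:
  fixes e :: "'b::linorder \<Rightarrow> 'c::linorder"
  assumes "strict_mono_on D e"
  shows "strict_mono_on (e ` D) (inv_into D e)"
proof (rule strict_mono_onI)
  have inj: "inj_on e D" using assms by (rule strict_mono_on_imp_inj_on)
  fix r s assume "r \<in> e ` D" "s \<in> e ` D" "r < s"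
  then show "inv_into D e r < inv_into D e s"
    using inj strict_mono_on_less[OF assms] by auto
qed

text \<open>A normal form: the positive letters are listed in their original order along
  \<open>e\<close>, and the total stays 1 because only zero terms disappear.\<close>

lemma delete_zero_entries:
  assumes "distribution_on X p"
  obtains X' e where "distribution_on X' (p \<circ> e)" "differ_by_zero_entries X p X' (p \<circ> e)"
    "dom X' = index_range (positive_indices X p)"
    "bij_betw e (index_range (positive_indices X p)) (positive_indices X p)"
proof -
  let ?P = "positive_indices X p"
  let ?D = "index_range ?P"
  obtain e where e: "bij_betw e ?D ?P" "strict_mono_on ?D e"
    by (rule index_range_enumeration)
  note inj = bij_betw_imp_inj_on[OF e(1)] and img = bij_betw_imp_surj_on[OF e(1)]
  define X' where "X' k = (if k \<in> ?D then X (e k) else None)" for k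
  have P: "?P \<subseteq> dom X" by (auto simp: positive_indices_def)
  have pos: "e k \<in> dom X" "0 < p (e k)" if "k \<in> ?D" for k
    using bij_betwE[OF e(1)] that by (auto simp: positive_indices_def)
  have dom: "dom X' = ?D"
    using pos by (force simp: X'_def dom_def split: if_splits)
  have injX: "inj_on X (dom X)" and nonneg: "\<And>k. k \<in> dom X \<Longrightarrow> 0 \<le> p k"
    and sum: "(p has_sum 1) (dom X)"
    using assms by (auto simp: distribution_on_def alphabet_def)
  have "inj_on (X \<circ> e) ?D"
    by (rule comp_inj_on[OF inj]) (use img P injX inj_on_subset in auto)
  then have "inj_on X' ?D"
    by (rule inj_on_cong[THEN iffD1, rotated]) (simp add: X'_def)
  then have alphabet: "alphabet X'"
    unfolding alphabet_def dom by (simp add: index_range_def) blast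
  have "(p has_sum 1) ?P"
    by (rule has_sum_cong_neutral[THEN iffD1, OF _ _ _ sum])
      (use nonneg in \<open>force simp: positive_indices_def\<close>)+
  then have "((p \<circ> e) has_sum 1) ?D"
    using has_sum_reindex_bij_betw[OF e(1), of p] by (simp add: comp_def)
  then have dist: "distribution_on X' (p \<circ> e)"
    using alphabet pos by (auto simp: distribution_on_def dom less_imp_le)
  have P': "positive_indices X' (p \<circ> e) = ?D"
    using pos unfolding positive_indices_def[of X'] dom by auto
  have "differ_by_zero_entries X p X' (p \<circ> e)"
    unfolding differ_by_zero_entries_def P'
  proof (intro exI conjI ballI)
    \<comment> \<open>The required shift runs from the old indices to the new ones, hence it is the
      inverse of \<open>e\<close>.\<close>
    show "bij_betw (inv_into ?D e) ?P ?D" by (rule bij_betw_inv_into[OF e(1)])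
    show "strict_mono_on ?P (inv_into ?D e)"
      using strict_mono_on_inv_into[OF e(2)] img by simp
    fix k assume k: "k \<in> ?P"
    have "inv_into ?D e k \<in> ?D" "e (inv_into ?D e k) = k"
      using k img by (auto intro: inv_into_into f_inv_into_f)
    then show "X' (inv_into ?D e k) = X k" "(p \<circ> e) (inv_into ?D e k) = p k"
      by (simp_all add: X'_def)
  qed
  with dist show thesis using dom e(1) by (rule that)
qed

section \<open>Permuting the index set, and the conclusion\<close>

lemma distribution_on_permute:
  assumes "distribution_on X p" and perm: "\<pi> permutes dom X"
  shows "distribution_on (X \<circ> \<pi>) (p \<circ> \<pi>)" and "dom (X \<circ> \<pi>) = dom X"
proof -
  have mem: "\<pi> k \<in> dom X \<longleftrightarrow> k \<in> dom X" for k
    using perm by (rule permutes_in_image)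
  then show dom: "dom (X \<circ> \<pi>) = dom X" by (force simp: dom_def)
  have "inj_on (X \<circ> \<pi>) (dom X)"
    using assms(1) permutes_image[OF perm] permutes_inj_on[OF perm]
    by (intro comp_inj_on) (auto simp: distribution_on_def alphabet_def)
  moreover have "((p \<circ> \<pi>) has_sum 1) (dom X)"
    using has_sum_reindex_bij_betw[OF permutes_imp_bij[OF perm], of p] assms(1)
    by (simp add: distribution_on_def comp_def)
  ultimately show "distribution_on (X \<circ> \<pi>) (p \<circ> \<pi>)"
    using assms(1) mem unfolding distribution_on_def alphabet_def dom by auto
qed

theorem theorem1:
  fixes \<theta> :: "(nat \<rightharpoonup> 'a) \<Rightarrow> (nat \<Rightarrow> real) \<Rightarrow> ereal"
    and X Y :: "nat \<rightharpoonup> 'a"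
    and p q :: "nat \<Rightarrow> real"
  assumes "diversity_index \<theta>"
    and "axiom_A01 \<theta>"
    and "axiom_A02 \<theta>"
    and "distribution_on X p"
    and "distribution_on Y q"
    and "\<And>v. zeta1 X p v = zeta1 Y q v"
  shows "\<theta> X p = \<theta> Y q"
proof -
  obtain h where h: "bij_betw h (positive_indices X p) (positive_indices Y q)"
    "\<And>k. k \<in> positive_indices X p \<Longrightarrow> q (h k) = p k"
    using bij_betw_positive_indices[OF assms(4-6)] by blast
  define D where "D = index_range (positive_indices X p)"
  obtain X' e where X': "distribution_on X' (p \<circ> e)" "differ_by_zero_entries X p X' (p \<circ> e)"
    "dom X' = D" "bij_betw e D (positive_indices X p)"
    unfolding D_def by (rule delete_zero_entries[OF assms(4)])
  obtain Y' f where Y': "distribution_on Y' (q \<circ> f)" "differ_by_zero_entries Y q Y' (q \<circ> f)"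
    "dom Y' = D" "bij_betw f D (positive_indices Y q)"
    \<comment> \<open>The bijection \<open>h\<close> identifies the two canonical index sets, so
      \<open>Y'\<close> also has domain \<open>D\<close>.\<close>
    unfolding D_def index_range_cong_bij_betw[OF h(1)] by (rule delete_zero_entries[OF assms(5)])
  \<comment> \<open>The route goes from \<open>D\<close> along \<open>e\<close> to the support of
    \<open>p\<close>, along \<open>h\<close> to the support of \<open>q\<close>, and back to
    \<open>D\<close> against \<open>f\<close>. Outside \<open>D\<close> it is the identity, as
    \<open>permutes\<close> demands.\<close>
  define \<pi> where "\<pi> k = (if k \<in> D then inv_into D f (h (e k)) else k)" for k
  have "bij_betw (inv_into D f \<circ> (h \<circ> e)) D D"
    by (intro bij_betw_trans[OF bij_betw_trans[OF X'(4) h(1)]] bij_betw_inv_into[OF Y'(4)])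
  then have "bij_betw \<pi> D D"
    by (rule bij_betw_cong[THEN iffD1, rotated]) (simp add: \<pi>_def)
  then have perm: "\<pi> permutes dom Y'"
    unfolding Y'(3) by (rule bij_imp_permutes) (simp add: \<pi>_def)
  have "(p \<circ> e) k = ((q \<circ> f) \<circ> \<pi>) k" if "k \<in> D" for k
  proof -
    have ek: "e k \<in> positive_indices X p" using bij_betwE[OF X'(4)] that by blast
    then have "h (e k) \<in> f ` D"
      using bij_betwE[OF h(1)] bij_betw_imp_surj_on[OF Y'(4)] by blast
    then show ?thesis using h(2)[OF ek] that by (simp add: \<pi>_def f_inv_into_f)
  qed
  moreover note permuted = distribution_on_permute[OF Y'(1) perm]
  \<comment> \<open>The letters of \<open>X'\<close> and of the permuted \<open>Y'\<close> may
    differ; only the probabilities agree, which suffices for \<open>axiom_A01\<close>.\<close>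
  ultimately have "\<theta> X' (p \<circ> e) = \<theta> (Y' \<circ> \<pi>) ((q \<circ> f) \<circ> \<pi>)"
    using assms(2) X'(1,3) Y'(3) unfolding axiom_A01_def by metis
  also have "\<dots> = \<theta> Y' (q \<circ> f)"
    using assms(3) Y'(1) perm unfolding axiom_A02_def by blast
  finally have "\<theta> X' (p \<circ> e) = \<theta> Y' (q \<circ> f)" .
  moreover have "\<theta> X p = \<theta> X' (p \<circ> e)" "\<theta> Y q = \<theta> Y' (q \<circ> f)"
    using assms(1,4,5) X'(1,2) Y'(1,2) unfolding diversity_index_def by blast+
  ultimately show ?thesis by simp
qed

end
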